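(* Consider the system of $N$ pulse-coupled oscillators with delayed excitatory coupling described in the context, with delay $\tau$ and total coupling strength $\varepsilon$, where $0<\tau<1$ and $0<\varepsilon<1$. If $f(\tau)+\varepsilon\ge 1$, then the system has solutions in which some interspike intervals are not longer than $\tau$. For example, from initial phases $\phi_1(0)=\cdots=\phi_N(0)$ the oscillators fire synchronously with period $\tau$, i.e. all oscillators have the same firing times and the time between any two successive firings equals $\tau$.
   Context: The system: $N$ identical oscillators $i=1,\dots,N$ have phases $\phi_i(t)\in[0,1]$, $t\ge 0$. $\mathrm{Pre}(i)$ is the set of oscillators sending pulses to $i$, and $\mathrm{Post}(i)$ is the set of oscillators receiving pulses from $i$ (so $j\in\mathrm{Post}(i)$ iff $i\in\mathrm{Pre}(j)$). The function $f:[0,1]\to[0,1]$ is twice continuously differentiable with $f'>0$, $f''<0$, $f(0)=0$, $f(1)=1$. Dynamics: (1) In the absence of interaction, $\mathrm{d}\phi_i/\mathrm{d}t=1$. (2) When $\phi_i(t)=1$, oscillator $i$ fires at time $t$ and its phase is reset instantly: $\phi_i(t^+)=0$. (3) If oscillator $i$ fires at time $t$, it emits a spike, which reaches every $j\in\mathrm{Post}(i)$ at time $t+\tau$ and induces the phase jump $\phi_j(t+\tau)=f^{-1}(\min[1,f(\phi_j((t+\tau)^-))+\varepsilon_{ij}])$, where $\varepsilon_{ij}>0$ is the coupling strength from $i$ to $j$. If several spikes reach $j$ at the same time, their strengths are added in this formula. (A phase brought to $1$ by a jump at time $s$ means that the oscillator fires at time $s$.) Standing assumptions: the system starts at time $t=0$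 with initial phases $0<\phi_i(0)\le 1$, and no spikes emitted before time $0$ are present; there is no self-interaction, i.e. $i\notin\mathrm{Pre}(i)$; $0<\tau<1$; and for all $i$, $\sum_{j\in\mathrm{Pre}(i)}\varepsilon_{ji}=\varepsilon$ with $0<\varepsilon<1$. An interspike interval is the time between two successive firings of one oscillator. *)

theory Defs
  imports Complex_Main
begin

text \<open>Oscillators are the elements of a finite type \<open>'n\<close>, so N is the cardinality of \<open>'n\<close>.
  Phases are functions \<open>\<phi> i t\<close> of which only the values at times \<open>t \<ge> 0\<close> are meaningful.\<close>

text \<open>Derivatives at 0 and 1 are one-sided; values of \<open>f\<close> outside the unit interval are irrelevant.\<close>

definition rise_function :: "(real \<Rightarrow> real) \<Rightarrow> bool" where
  "rise_function f \<longleftrightarrow>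
     f ` {0..1} \<subseteq> {0..1} \<and> f 0 = 0 \<and> f 1 = 1 \<and>
     (\<exists>f' f''.
        (\<forall>x\<in>{0..1}. (f has_real_derivative f' x) (at x within {0..1})) \<and>
        (\<forall>x\<in>{0..1}. (f' has_real_derivative f'' x) (at x within {0..1})) \<and>
        continuous_on {0..1} f'' \<and>
        (\<forall>x\<in>{0..1}. f' x > 0 \<and> f'' x < 0))"

text \<open>\<open>Pre j\<close> is the set of oscillators sending pulses to \<open>j\<close>; \<open>w i j\<close> is the coupling strength
  from \<open>i\<close> to \<open>j\<close>, meaningful only for \<open>i \<in> Pre j\<close>.\<close>

definition coupling_network ::
  "('n::finite \<Rightarrow> 'n set) \<Rightarrow> ('n \<Rightarrow> 'n \<Rightarrow> real) \<Rightarrow> real \<Rightarrow> bool" where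
  "coupling_network Pre w \<epsilon> \<longleftrightarrow>
     (\<forall>i. i \<notin> Pre i) \<and>
     (\<forall>j. \<forall>i\<in>Pre j. w i j > 0) \<and>
     (\<forall>j. (\<Sum>i\<in>Pre j. w i j) = \<epsilon>)"

definition Post :: "('n \<Rightarrow> 'n set) \<Rightarrow> 'n \<Rightarrow> 'n set" where
  "Post Pre i = {j. i \<in> Pre j}"

definition firing_times :: "('n \<Rightarrow> real \<Rightarrow> real) \<Rightarrow> 'n \<Rightarrow> real set" where
  "firing_times \<phi> i = {t. 0 \<le> t \<and> \<phi> i t = 1}"

text \<open>The senders whose spikes reach \<open>j\<close> at time \<open>t\<close>. As firing times are nonnegative, no spike
  emitted before time 0 is present.\<close>

definition spikes_at ::
  "('n \<Rightarrow> 'n set) \<Rightarrow> real \<Rightarrow> ('n \<Rightarrow> real \<Rightarrow> real) \<Rightarrow> 'n \<Rightarrow> real \<Rightarrow> 'n set" where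
  "spikes_at Pre \<tau> \<phi> j t = {i. j \<in> Post Pre i \<and> t - \<tau> \<in> firing_times \<phi> i}"

text \<open>The value \<open>\<phi> j t\<close> is the phase after any jump caused by spikes arriving at \<open>t\<close> but before the
  reset: at a firing it is 1 and the right limit is 0. Since all one-sided limits are required to
  exist, firing times cannot accumulate.\<close>

definition solution ::
  "(real \<Rightarrow> real) \<Rightarrow> ('n::finite \<Rightarrow> 'n set) \<Rightarrow> ('n \<Rightarrow> 'n \<Rightarrow> real) \<Rightarrow> real \<Rightarrow>
   ('n \<Rightarrow> real \<Rightarrow> real) \<Rightarrow> bool" where
  "solution f Pre w \<tau> \<phi> \<longleftrightarrow>
     (\<forall>j. 0 < \<phi> j 0 \<and> \<phi> j 0 \<le> 1) \<and>
     (\<forall>j. \<forall>t\<ge>0. \<phi> j t \<in> {0..1}) \<and>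
     (\<forall>j. \<forall>t\<ge>0. spikes_at Pre \<tau> \<phi> j t = {} \<and> \<phi> j t \<noteq> 1 \<longrightarrow>
        (\<phi> j has_real_derivative 1) (at t within {0..})) \<and>
     (\<forall>j. \<forall>t\<ge>0. (\<phi> j \<longlongrightarrow> (if \<phi> j t = 1 then 0 else \<phi> j t)) (at_right t)) \<and>
     (\<forall>j. \<forall>t>0. \<exists>l. (\<phi> j \<longlongrightarrow> l) (at_left t) \<and>
        \<phi> j t =
          (if spikes_at Pre \<tau> \<phi> j t = {} then l
           else inv_into {0..1} f (min 1 (f l + (\<Sum>i\<in>spikes_at Pre \<tau> \<phi> j t. w i j)))))"

definition successive_firings :: "('n \<Rightarrow> real \<Rightarrow> real) \<Rightarrow> 'n \<Rightarrow> real \<Rightarrow> real \<Rightarrow> bool" where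
  "successive_firings \<phi> i s t \<longleftrightarrow>
     s \<in> firing_times \<phi> i \<and> t \<in> firing_times \<phi> i \<and> s < t \<and> {s<..<t} \<inter> firing_times \<phi> i = {}"

text \<open>The first two conjuncts on \<open>firing_times \<phi> i\<close> say that firing occurs and never stops, so that
  the condition on successive firings is not vacuous.\<close>

definition synchronous_with_period :: "('n \<Rightarrow> real \<Rightarrow> real) \<Rightarrow> real \<Rightarrow> bool" where
  "synchronous_with_period \<phi> T \<longleftrightarrow>
     (\<forall>i j. firing_times \<phi> i = firing_times \<phi> j) \<and>
     (\<forall>i. firing_times \<phi> i \<noteq> {} \<and>
          (\<forall>s\<in>firing_times \<phi> i. \<exists>t. successive_firings \<phi> i s t) \<and>
          (\<forall>s t. successive_firings \<phi> i s t \<longrightarrow> t - s = T))"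

end

(* Synchronous firing at time s sends the total strength \<epsilon> to everyone at time s + \<tau>, when
   all phases have just reached \<tau>; since f \<tau> + \<epsilon> \<ge> 1 this makes all oscillators fire again.
   No spike arrives strictly in between, because the spikes on their way at any moment were all
   emitted at the last synchronous firing, and \<tau> < 1 rules out unforced firing. *)

theory Submission
  imports Defs
begin

section \<open>Affine phases\<close>

text \<open>Here and in the next two lemmas the formula is required only on the open interval,
  because at an endpoint the recorded phase may be a firing value or the result of a jump.\<close>

lemma affine_at_right:
  fixes g :: "real \<Rightarrow> real"
  assumes "a < b" and "\<And>s. a < s \<Longrightarrow> s < b \<Longrightarrow> g s = p + (s - a)"
  shows "(g \<longlongrightarrow> p) (at_right a)"
proof -
  have "((\<lambda>s. p + (s - a)) \<longlongrightarrow> p + (a - a)) (at_right a)"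
    by (intro tendsto_intros)
  moreover have "\<forall>\<^sub>F s in at_right a. p + (s - a) = g s"
    using assms by (auto simp: eventually_at_right[of a b] intro!: exI[of _ b])
  ultimately show ?thesis
    using Lim_transform_eventually by fastforce
qed

lemma affine_at_left:
  fixes g :: "real \<Rightarrow> real"
  assumes "a < b" and "\<And>s. a < s \<Longrightarrow> s < b \<Longrightarrow> g s = p + (s - a)"
  shows "(g \<longlongrightarrow> p + (b - a)) (at_left b)"
proof -
  have "((\<lambda>s. p + (s - a)) \<longlongrightarrow> p + (b - a)) (at_left b)"
    by (intro tendsto_intros)
  moreover have "\<forall>\<^sub>F s in at_left b. p + (s - a) = g s"
    using assms by (auto simp: eventually_at_left[of a b] intro!: exI[of _ a])
  ultimately show ?thesis
    using Lim_transform_eventually by fastforce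
qed

lemma affine_has_derivative:
  fixes g :: "real \<Rightarrow> real"
  assumes "a < t" "t < b" and "\<And>s. a < s \<Longrightarrow> s < b \<Longrightarrow> g s = p + (s - a)"
  shows "(g has_real_derivative 1) (at t)"
proof (rule has_field_derivative_transform_within_open[where S = "{a<..<b}"])
  show "((\<lambda>s. p + (s - a)) has_real_derivative 1) (at t)"
    by (auto intro!: derivative_eq_intros)
qed (use assms in auto)

text \<open>Subtracting the identity leaves a function with derivative zero, hence a constant on the
  open interval. The right limit at \<open>a\<close>, not \<open>g a\<close>, fixes the constant: at
  a firing the value is 1 while the motion restarts from 0.\<close>

lemma deriv_one_imp_affine:
  fixes g :: "real \<Rightarrow> real"
  assumes "\<And>s. a < s \<Longrightarrow> s < b \<Longrightarrow> (g has_real_derivative 1) (at s)"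
    and lim: "(g \<longlongrightarrow> p) (at_right a)"
    and t: "a < t" "t < b"
  shows "g t = p + (t - a)"
proof -
  have D: "DERIV (\<lambda>s. g s - s) s :> 0" if "s \<in> {a<..<b}" for s
    using assms(1)[of s] that by (auto intro!: derivative_eq_intros)
  have const: "g s - s = g t - t" if "a < s" "s < b" for s
    using DERIV_isconst3[of a b s t "\<lambda>s. g s - s"] D that t by auto
  have "(g \<longlongrightarrow> g t - t + a) (at_right a)"
  proof (rule affine_at_right[where b = b])
    show "g s = g t - t + a + (s - a)" if "a < s" "s < b" for s
      using const[OF that] by simp
  qed (use t in simp)
  with lim have "p = g t - t + a"
    using tendsto_unique trivial_limit_at_right_real by blast
  then show ?thesis
    by simp
qed

section \<open>Coupling\<close>

lemma rise_function_less_one: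
  assumes "rise_function f" "0 \<le> x" "x < 1"
  shows "f x < 1"
proof -
  from assms(1) obtain f' where f1: "f 1 = 1"
    and D: "\<And>x. x \<in> {0..1} \<Longrightarrow> (f has_real_derivative f' x) (at x within {0..1})"
    and pos: "\<And>x. x \<in> {0..1} \<Longrightarrow> f' x > 0"
    unfolding rise_function_def by blast
  \<comment> \<open>Differentiability at 0 and 1 is only one-sided, so the mean value argument takes
    derivatives in the interior and continuity on the closed interval.\<close>
  have "f x < f 1"
  proof (rule DERIV_pos_imp_increasing_open[OF assms(3)])
    fix s assume s: "x < s" "s < 1"
    then have "(f has_real_derivative f' s) (at s within {0<..<1})"
      using D[of s] assms(2) by (auto intro: has_field_derivative_subset)
    then show "\<exists>y. DERIV f s :> y \<and> y > 0"
      using s assms(2) pos[of s] by (auto simp: at_within_open[of s "{0<..<1}"])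
  next
    have "continuous_on {0..1} f"
      using D by (intro DERIV_continuous_on)
    then show "continuous_on {x..1} f"
      by (rule continuous_on_subset) (use assms in auto)
  qed
  then show ?thesis
    by (simp add: f1)
qed

text \<open>\<open>inv_into\<close> returns some preimage of 1 in the unit interval, and points
  below 1 have values below 1, so the choice is forced.\<close>

lemma inv_into_rise_function_one:
  assumes "rise_function f"
  shows "inv_into {0..1} f 1 = 1"
proof -
  have "1 \<in> f ` {0..1}"
    using assms unfolding rise_function_def by force
  then have "inv_into {0..1} f 1 \<in> {0..1}" "f (inv_into {0..1} f 1) = 1"
    by (rule inv_into_into, rule f_inv_into_f)
  then show ?thesis
    using rise_function_less_one[OF assms, of "inv_into {0..1} f 1"] by force
qed

text \<open>An empty sum would be 0. This matters because \<open>solution\<close> applies the jump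
  formula only to a nonempty set of arriving spikes.\<close>

lemma coupling_network_Pre_nonempty:
  assumes "coupling_network Pre w \<epsilon>" "0 < \<epsilon>"
  shows "Pre j \<noteq> {}"
proof
  assume "Pre j = {}"
  moreover have "(\<Sum>i\<in>Pre j. w i j) = \<epsilon>"
    using assms(1) by (simp add: coupling_network_def)
  ultimately show False
    using assms(2) by simp
qed

lemma spikes_at_iff:
  "i \<in> spikes_at Pre \<tau> \<phi> j t \<longleftrightarrow> i \<in> Pre j \<and> 0 \<le> t - \<tau> \<and> \<phi> i (t - \<tau>) = 1"
  by (auto simp: spikes_at_def Post_def firing_times_def)

lemma full_volley_jump:
  assumes "rise_function f" "coupling_network Pre w \<epsilon>" "f \<tau> + \<epsilon> \<ge> 1"
  shows "inv_into {0..1} f (min 1 (f \<tau> + (\<Sum>i\<in>Pre j. w i j))) = 1"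
proof -
  have "min 1 (f \<tau> + (\<Sum>i\<in>Pre j. w i j)) = 1"
    using assms(2,3) by (simp add: coupling_network_def)
  then show ?thesis
    using inv_into_rise_function_one[OF assms(1)] by simp
qed

section \<open>Dynamics without incoming spikes\<close>

lemma solution_deriv:
  assumes "solution f Pre w \<tau> \<phi>" "0 < t" "spikes_at Pre \<tau> \<phi> j t = {}" "\<phi> j t \<noteq> 1"
  shows "(\<phi> j has_real_derivative 1) (at t)"
proof -
  have "(\<phi> j has_real_derivative 1) (at t within {0..})"
    using assms by (simp add: solution_def)
  then have "(\<phi> j has_real_derivative 1) (at t within {0<..})"
    by (rule has_field_derivative_subset) auto
  then show ?thesis
    using assms(2) by (simp add: at_within_open[of t "{0<..}"])
qed

lemma solution_at_right:
  assumes "solution f Pre w \<tau> \<phi>" "0 \<le> t"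
  shows "(\<phi> j \<longlongrightarrow> (if \<phi> j t = 1 then 0 else \<phi> j t)) (at_right t)"
  using assms by (simp add: solution_def)

text \<open>Left limits are unique, so the limit provided by \<open>solution\<close> agrees with any
  that has been computed.\<close>

lemma solution_from_left_limit:
  assumes "solution f Pre w \<tau> \<phi>" "0 < t" "(\<phi> j \<longlongrightarrow> l) (at_left t)"
  shows "\<phi> j t = (if spikes_at Pre \<tau> \<phi> j t = {} then l
           else inv_into {0..1} f (min 1 (f l + (\<Sum>i\<in>spikes_at Pre \<tau> \<phi> j t. w i j))))"
proof -
  obtain l' where l': "(\<phi> j \<longlongrightarrow> l') (at_left t)"
    "\<phi> j t = (if spikes_at Pre \<tau> \<phi> j t = {} then l'
           else inv_into {0..1} f (min 1 (f l' + (\<Sum>i\<in>spikes_at Pre \<tau> \<phi> j t. w i j))))"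
    using assms(1,2) unfolding solution_def by blast
  have "l' = l"
    using tendsto_unique[OF trivial_limit_at_left_real l'(1) assms(3)] .
  with l'(2) show ?thesis
    by simp
qed

text \<open>Unit slope is granted only where the phase is not 1, so firings inside the interval must
  be excluded first. At the infimum of the supposed firing times the phase has grown affinely from
  \<open>p\<close> and is still below 1, since 1 can be reached at \<open>b\<close> at the earliest;
  a right limit below 1 then leaves no room for firings just after.\<close>

lemma solution_affine_without_spikes:
  assumes sol: "solution f Pre w \<tau> \<phi>"
    and "0 \<le> a" "p + (b - a) \<le> 1"
    and lim: "(\<phi> j \<longlongrightarrow> p) (at_right a)"
    and no_spikes: "\<And>s. a < s \<Longrightarrow> s < b \<Longrightarrow> spikes_at Pre \<tau> \<phi> j s = {}"
    and t: "a < t" "t < b"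
  shows "\<phi> j t = p + (t - a)"
proof -
  define S where "S = {s. a < s \<and> s < b \<and> \<phi> j s = 1}"
  \<comment> \<open>Stated for any lower bound \<open>m\<close> of \<open>S\<close> up to
    \<open>b\<close>, as it serves twice: with the infimum of \<open>S\<close> to refute firing,
    then with \<open>b\<close> once \<open>S\<close> is empty.\<close>
  have affine: "\<phi> j s = p + (s - a)" if "m \<le> b" "\<And>x. x \<in> S \<Longrightarrow> m \<le> x" "a < s" "s < m" for m s
  proof (rule deriv_one_imp_affine[OF _ lim that(3,4)])
    fix x assume x: "a < x" "x < m"
    then have "x \<notin> S"
      using that(2) by force
    then have "\<phi> j x \<noteq> 1"
      using x that(1) by (auto simp: S_def)
    then show "(\<phi> j has_real_derivative 1) (at x)"
      using x that(1) \<open>0 \<le> a\<close> by (intro solution_deriv[OF sol] no_spikes) auto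
  qed
  have "S = {}"
  proof (rule ccontr)
    assume "S \<noteq> {}"
    define m where "m = Inf S"
    have bdd: "bdd_below S"
      by (rule bdd_belowI[of _ a]) (auto simp: S_def)
    have m_le: "m \<le> x" if "x \<in> S" for x
      unfolding m_def using bdd that by (rule cInf_lower[rotated])
    have "a \<le> m"
      unfolding m_def using \<open>S \<noteq> {}\<close> by (intro cInf_greatest) (auto simp: S_def)
    have "m < b"
      using \<open>S \<noteq> {}\<close> m_le by (force simp: S_def)
    \<comment> \<open>An infimum outside \<open>S\<close> is approached from the right by points of
      \<open>S\<close>, where the phase is 1.\<close>
    have right_one: "False" if "(\<phi> j \<longlongrightarrow> q) (at_right m)" "q < 1" "m \<notin> S" for q
    proof -
      have "\<forall>\<^sub>F s in at_right m. \<phi> j s < 1"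
        using that(1,2) by (rule order_tendstoD)
      then obtain d where d: "d > m" "\<And>s. m < s \<Longrightarrow> s < d \<Longrightarrow> \<phi> j s < 1"
        by (auto simp: eventually_at_right[of m "m + 1"])
      obtain x where "x \<in> S" "x < d"
        using cInf_lessD[OF \<open>S \<noteq> {}\<close>, of d] d(1) by (auto simp: m_def)
      moreover have "m < x"
        using m_le[OF \<open>x \<in> S\<close>] \<open>x \<in> S\<close> that(3) by (cases "m = x") auto
      ultimately show False
        using d(2)[of x] by (auto simp: S_def)
    qed
    show False
    proof (cases "m = a")
      case True
      show False
        using right_one[of p] lim True \<open>m < b\<close> assms(3) by (auto simp: S_def)
    next
      case False
      then have "a < m"
        using \<open>a \<le> m\<close> by simp
      then have "(\<phi> j \<longlongrightarrow> p + (m - a)) (at_left m)"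
        using affine[of m] m_le \<open>m < b\<close> by (intro affine_at_left) auto
      then have "\<phi> j m = p + (m - a)"
        using solution_from_left_limit[OF sol, of m j] no_spikes[of m] \<open>a < m\<close> \<open>m < b\<close> \<open>0 \<le> a\<close>
        by simp
      then have "\<phi> j m < 1"
        using assms(3) \<open>m < b\<close> by simp
      \<comment> \<open>Below 1 there is no reset, so the right limit at \<open>m\<close> is the
        value itself.\<close>
      moreover from this have "(\<phi> j \<longlongrightarrow> \<phi> j m) (at_right m)"
        using solution_at_right[OF sol, of m j] \<open>a < m\<close> \<open>0 \<le> a\<close> by simp
      ultimately show False
        using right_one[of "\<phi> j m"] by (auto simp: S_def)
    qed
  qed
  then show ?thesis
    using affine[of b t] t by simp
qed

section \<open>Periodic firing times\<close>

definition periodic_times :: "real \<Rightarrow> real \<Rightarrow> real set" where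
  "periodic_times t0 T = range (\<lambda>k::nat. t0 + real k * T)"

lemma periodic_times_cases:
  assumes "0 < T" "t0 \<le> t"
  obtains k where "t = t0 + real k * T"
    | k where "t0 + real k * T < t" "t < t0 + real (Suc k) * T"
proof -
  define k where "k = nat \<lfloor>(t - t0) / T\<rfloor>"
  have "0 \<le> (t - t0) / T"
    using assms by simp
  then have "real k \<le> (t - t0) / T" "(t - t0) / T < real k + 1"
    unfolding k_def by linarith+
  then have "real k * T \<le> t - t0" "t - t0 < (real k + 1) * T"
    using assms(1) by (simp_all add: field_simps)
  then show ?thesis
    using that(1)[of k] that(2)[of k] by (force simp: less_le add.commute)
qed

lemma not_periodic_time_between:
  assumes "0 < T" "t0 + real k * T < t" "t < t0 + real (Suc k) * T"
  shows "t \<notin> periodic_times t0 T"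
proof
  assume "t \<in> periodic_times t0 T"
  then obtain m where "t = t0 + real m * T"
    by (auto simp: periodic_times_def)
  with assms have "real k < real m" "real m < real (Suc k)"
    by (simp_all only: add_less_cancel_left mult_less_cancel_right_pos)
  then show False
    by simp
qed

lemma synchronous_with_periodI:
  assumes "0 < T" and fire: "\<And>i. firing_times \<phi> i = periodic_times t0 T"
  shows "synchronous_with_period \<phi> T"
proof -
  have mem: "t0 + real k * T \<in> periodic_times t0 T" for k
    by (auto simp: periodic_times_def)
  have succ: "successive_firings \<phi> i (t0 + real k * T) (t0 + real (Suc k) * T)" for i k
    using assms(1) mem[of k] mem[of "Suc k"] not_periodic_time_between[OF assms(1), of t0 k]
    unfolding successive_firings_def fire by (auto simp: algebra_simps)
  have "t - s = T" if st: "successive_firings \<phi> i s t" for i s t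
  proof -
    from st obtain m n where m: "s = t0 + real m * T" and n: "t = t0 + real n * T"
      by (auto simp: successive_firings_def fire periodic_times_def)
    \<comment> \<open>The time \<open>s + T\<close> is itself a firing time, so it cannot lie
      strictly between successive firings.\<close>
    have "s < t" "\<not> (t0 + real (Suc m) * T \<in> {s<..<t})"
      using st mem[of "Suc m"] unfolding successive_firings_def fire by auto
    then have "m < n" "\<not> Suc m < n"
      unfolding m n using assms(1) by (auto simp: mult_less_cancel_right_pos)
    then have "n = Suc m"
      by simp
    then show ?thesis
      by (simp add: m n algebra_simps)
  qed
  moreover have "\<exists>t. successive_firings \<phi> i s t" if "s \<in> firing_times \<phi> i" for i s
    using that succ by (auto simp: fire periodic_times_def)
  moreover have "firing_times \<phi> i \<noteq> {}" for i
    by (simp add: fire periodic_times_def)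
  ultimately show ?thesis
    by (auto simp: synchronous_with_period_def fire)
qed

section \<open>Every solution from equal phases fires synchronously\<close>

text \<open>Method of steps for a delay: a spike arriving at \<open>s\<close> was emitted at
  \<open>s - \<tau>\<close>, so phases known to be below 1 on one window of length \<tau> exclude
  spikes on the next.\<close>

lemma solution_before_first_firing:
  assumes sol: "solution f Pre w \<tau> \<phi>" and init: "\<And>i. \<phi> i 0 = c"
    and "0 < \<tau>" and t: "0 \<le> t" "t < 1 - c"
  shows "\<phi> j t = c + t"
proof -
  have "\<forall>j t. 0 \<le> t \<and> t < 1 - c \<and> t < real n * \<tau> \<longrightarrow> \<phi> j t = c + t" for n
  proof (induction n)
    case (Suc n)
    show ?case
    proof (intro allI impI)
      fix j t assume t: "0 \<le> t \<and> t < 1 - c \<and> t < real (Suc n) * \<tau>"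
      show "\<phi> j t = c + t"
      proof (cases "t = 0")
        case False
        have "\<phi> j t = c + (t - 0)"
        proof (rule solution_affine_without_spikes[OF sol, where b = "min (1 - c) (real (Suc n) * \<tau>)"])
          show "(\<phi> j \<longlongrightarrow> c) (at_right 0)"
            using solution_at_right[OF sol, of 0 j] t by (simp add: init)
          fix s assume "0 < s" "s < min (1 - c) (real (Suc n) * \<tau>)"
          then have "\<phi> i (s - \<tau>) = c + (s - \<tau>)" "c + (s - \<tau>) < 1" if "0 \<le> s - \<tau>" for i
            using Suc.IH[rule_format, of "s - \<tau>" i] that \<open>0 < \<tau>\<close> by (auto simp: algebra_simps)
          then show "spikes_at Pre \<tau> \<phi> j s = {}"
            by (fastforce simp: spikes_at_iff)
        qed (use t False in auto)
        then show ?thesis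
          by simp
      qed (simp add: init)
    qed
  qed simp
  moreover obtain n where "t < real n * \<tau>"
    using reals_Archimedean3[OF \<open>0 < \<tau>\<close>] by blast
  ultimately show ?thesis
    using t by blast
qed

lemma solution_synchronous:
  assumes f: "rise_function f" and net: "coupling_network Pre w \<epsilon>"
    and "0 < \<tau>" "\<tau> < 1" "0 < \<epsilon>" and sup: "f \<tau> + \<epsilon> \<ge> 1"
    and sol: "solution f Pre w \<tau> \<phi>" and init: "\<And>i. \<phi> i 0 = c"
  shows "synchronous_with_period \<phi> \<tau>"
proof -
  have "0 < c" "c \<le> 1"
    using sol init unfolding solution_def by metis+
  let ?t = "\<lambda>k::nat. 1 - c + real k * \<tau>"
  have before: "\<phi> j s \<noteq> 1" if "0 \<le> s" "s < 1 - c" for j s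
    using solution_before_first_firing[OF sol init \<open>0 < \<tau>\<close> that, of j] that by simp
  \<comment> \<open>For \<open>c = 1\<close> the firing is at time 0, where \<open>solution\<close>
    prescribes no left limit, so the initial value itself is used.\<close>
  have first: "\<phi> j (1 - c) = 1" for j
  proof (cases "c = 1")
    case False
    then have "(\<phi> j \<longlongrightarrow> c + (1 - c - 0)) (at_left (1 - c))"
      using solution_before_first_firing[OF sol init \<open>0 < \<tau>\<close>, of _ j] \<open>c \<le> 1\<close>
      by (intro affine_at_left) auto
    moreover have "spikes_at Pre \<tau> \<phi> j (1 - c) = {}"
      using before[of "1 - c - \<tau>"] \<open>0 < \<tau>\<close> by (auto simp: spikes_at_iff)
    ultimately show ?thesis
      using solution_from_left_limit[OF sol, of "1 - c" j] False \<open>c \<le> 1\<close> by simp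
  qed (simp add: init)
  \<comment> \<open>Spikes landing strictly between \<open>?t k\<close> and
    \<open>?t (Suc k)\<close> were emitted strictly inside the window of length \<tau> before
    \<open>?t k\<close>. The restriction \<open>0 \<le> s\<close> matters because this window may
    extend below time 0, where phases carry no meaning.\<close>
  have step: "(\<forall>s. ?t k < s \<and> s < ?t (Suc k) \<longrightarrow> \<phi> j s = s - ?t k) \<and> \<phi> j (?t (Suc k)) = 1"
    if quiet: "\<And>i s. 0 \<le> s \<Longrightarrow> ?t k - \<tau> < s \<Longrightarrow> s < ?t k \<Longrightarrow> \<phi> i s \<noteq> 1"
      and all_fire: "\<And>i. \<phi> i (?t k) = 1" for j k
  proof -
    have pos: "0 \<le> ?t k" "?t (Suc k) = ?t k + \<tau>"
      using \<open>c \<le> 1\<close> \<open>0 < \<tau>\<close> by (auto simp: distrib_right intro!: add_nonneg_nonneg)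
    have affine: "\<phi> j s = 0 + (s - ?t k)" if "?t k < s" "s < ?t (Suc k)" for s
    proof (rule solution_affine_without_spikes[OF sol pos(1) _ _ _ that])
      show "(\<phi> j \<longlongrightarrow> 0) (at_right (?t k))"
        using solution_at_right[OF sol pos(1), of j] by (simp add: all_fire)
      fix x assume "?t k < x" "x < ?t (Suc k)"
      then have "?t k - \<tau> < x - \<tau>" "x - \<tau> < ?t k"
        unfolding pos(2) by simp_all
      then show "spikes_at Pre \<tau> \<phi> j x = {}"
        using quiet by (auto simp: spikes_at_iff)
    qed (use \<open>\<tau> < 1\<close> pos(2) in simp)
    \<comment> \<open>This left limit is \<tau>, the phase for which \<open>full_volley_jump\<close>
      is stated.\<close>
    have "(\<phi> j \<longlongrightarrow> 0 + (?t (Suc k) - ?t k)) (at_left (?t (Suc k)))"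
      using affine pos(2) \<open>0 < \<tau>\<close> by (intro affine_at_left) auto
    moreover have "spikes_at Pre \<tau> \<phi> j (?t (Suc k)) = Pre j"
      using all_fire pos(1) unfolding pos(2) by (auto simp: spikes_at_iff)
    ultimately have "\<phi> j (?t (Suc k)) = 1"
      using solution_from_left_limit[OF sol, of "?t (Suc k)" j] pos \<open>0 < \<tau>\<close>
        full_volley_jump[OF f net sup, of j] coupling_network_Pre_nonempty[OF net \<open>0 < \<epsilon>\<close>, of j]
      by simp
    with affine show ?thesis
      by simp
  qed
  \<comment> \<open>Quietness and firing are carried jointly: the window before
    \<open>?t (Suc k)\<close> starts at \<open>?t k\<close>, and the phases in it are elapsed times
    below \<tau>, hence below 1.\<close>
  have all: "(\<forall>i s. 0 \<le> s \<and> ?t k - \<tau> < s \<and> s < ?t k \<longrightarrow> \<phi> i s \<noteq> 1) \<and> (\<forall>i. \<phi> i (?t k) = 1)" for k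
  proof (induction k)
    case 0
    show ?case
      using before first by simp
  next
    case (Suc k)
    have "?t (Suc k) = ?t k + \<tau>"
      by (simp add: algebra_simps)
    then show ?case
      using step[of k] Suc.IH \<open>\<tau> < 1\<close> by auto
  qed
  have "firing_times \<phi> i = periodic_times (1 - c) \<tau>" for i
  proof (intro equalityI subsetI)
    fix s assume "s \<in> firing_times \<phi> i"
    then have s: "0 \<le> s" "\<phi> i s = 1"
      by (auto simp: firing_times_def)
    then have "1 - c \<le> s"
      using before[of s i] by force
    with \<open>0 < \<tau>\<close> show "s \<in> periodic_times (1 - c) \<tau>"
    proof (cases rule: periodic_times_cases)
      \<comment> \<open>The time \<open>s\<close> lies in the quiet window that precedes the later
        neighbour, hence the index \<open>Suc k\<close> below.\<close>
      case (2 k)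
      then have "\<phi> i s \<noteq> 1"
        using all[of "Suc k"] s(1) by (auto simp: algebra_simps)
      with s show ?thesis
        by simp
    qed (auto simp: periodic_times_def)
  next
    fix s assume "s \<in> periodic_times (1 - c) \<tau>"
    then show "s \<in> firing_times \<phi> i"
      using all \<open>c \<le> 1\<close> \<open>0 < \<tau>\<close>
      by (auto simp: periodic_times_def firing_times_def intro!: add_nonneg_nonneg)
  qed
  then show ?thesis
    by (rule synchronous_with_periodI[OF \<open>0 < \<tau>\<close>])
qed

section \<open>Existence of the synchronous solution\<close>

text \<open>The last branch is \<open>t - (1 - c)\<close> modulo \<tau>, the time since the latest
  firing. The first branch takes precedence because \<open>solution\<close> records 1 at a firing,
  where this remainder would be 0.\<close>

definition synchronous_phase :: "real \<Rightarrow> real \<Rightarrow> real \<Rightarrow> real" where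
  "synchronous_phase c \<tau> t =
     (if t \<in> periodic_times (1 - c) \<tau> then 1
      else if t < 1 - c then t + c
      else \<tau> * frac ((t - (1 - c)) / \<tau>))"

lemma synchronous_phase_before:
  assumes "0 < \<tau>" "s < 1 - c"
  shows "synchronous_phase c \<tau> s = s + c"
proof -
  have "s \<notin> periodic_times (1 - c) \<tau>"
    using assms by (auto simp: periodic_times_def mult_less_0_iff)
  then show ?thesis
    using assms by (simp add: synchronous_phase_def)
qed

lemma synchronous_phase_0:
  assumes "0 < \<tau>" "c \<le> 1"
  shows "synchronous_phase c \<tau> 0 = c"
proof (cases "c = 1")
  case True
  then show ?thesis
    by (auto simp: synchronous_phase_def periodic_times_def)
next
  case False
  then show ?thesis
    using synchronous_phase_before[OF assms(1), of 0 c] assms(2) by simp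
qed

lemma synchronous_phase_between:
  assumes "0 < \<tau>" and s: "1 - c + real k * \<tau> < s" "s < 1 - c + real (Suc k) * \<tau>"
  shows "synchronous_phase c \<tau> s = s - (1 - c + real k * \<tau>)"
proof -
  have "\<not> s < 1 - c"
    using s(1) assms(1) by (smt (verit) mult_nonneg_nonneg of_nat_0_le_iff)
  moreover have "\<lfloor>(s - (1 - c)) / \<tau>\<rfloor> = int k"
    using assms by (intro floor_unique) (auto simp: field_simps)
  ultimately show ?thesis
    using not_periodic_time_between[OF assms] assms(1)
    by (simp add: synchronous_phase_def frac_def field_simps)
qed

lemma solution_synchronous_phase:
  assumes f: "rise_function f" and net: "coupling_network Pre w \<epsilon>"
    and "0 < \<tau>" "\<tau> < 1" "0 < \<epsilon>" and sup: "f \<tau> + \<epsilon> \<ge> 1"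
    and "0 < c" "c \<le> 1"
  shows "solution f Pre w \<tau> (\<lambda>_. synchronous_phase c \<tau>)"
proof -
  let ?t = "\<lambda>k::nat. 1 - c + real k * \<tau>"
  let ?g = "synchronous_phase c \<tau>"
  have Suc_t: "?t (Suc k) = ?t k + \<tau>" for k
    by (simp add: algebra_simps)
  have t_nonneg: "1 - c \<le> ?t k" for k
    using \<open>0 < \<tau>\<close> by simp
  have at_t: "?g (?t k) = 1" for k
    by (auto simp: synchronous_phase_def periodic_times_def)
  \<comment> \<open>The bound 1 on the length keeps the elapsed time \<open>s - a\<close> below 1
    inside the interval, which yields both \<open>fires_iff\<close> and the range of the
    phase.\<close>
  have cover: "(\<exists>k. t = ?t k) \<or>
      (\<exists>a b. a < t \<and> t < b \<and> b - a \<le> 1 \<and> (\<forall>s. a < s \<longrightarrow> s < b \<longrightarrow> ?g s = 0 + (s - a)))"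
    if "0 \<le> t" for t
  proof (cases "t < 1 - c")
    case True
    \<comment> \<open>\<open>- c\<close> is a virtual reset time: unit growth from phase 0 there
      gives phase \<open>c\<close> at time 0.\<close>
    have "- c < t \<and> t < 1 - c \<and> (1 - c) - (- c) \<le> 1 \<and>
        (\<forall>s. - c < s \<longrightarrow> s < 1 - c \<longrightarrow> ?g s = 0 + (s - (- c)))"
      using True that \<open>0 < c\<close> synchronous_phase_before[OF \<open>0 < \<tau>\<close>] by auto
    then show ?thesis
      by blast
  next
    case False
    then have "1 - c \<le> t"
      by simp
    with \<open>0 < \<tau>\<close> show ?thesis
    proof (cases rule: periodic_times_cases)
      case (2 k)
      have "?t k < t \<and> t < ?t (Suc k) \<and> ?t (Suc k) - ?t k \<le> 1 \<and>
          (\<forall>s. ?t k < s \<longrightarrow> s < ?t (Suc k) \<longrightarrow> ?g s = 0 + (s - ?t k))"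
        using 2 synchronous_phase_between[OF \<open>0 < \<tau>\<close>, of c k] \<open>\<tau> < 1\<close> Suc_t[of k] by auto
      then show ?thesis
        by blast
    qed blast
  qed
  have fires_iff: "?g t = 1 \<longleftrightarrow> (\<exists>k. t = ?t k)" if "0 \<le> t" for t
    using cover[OF that] at_t by force
  \<comment> \<open>The index \<open>Suc k\<close> records that the volley emitted at
    \<open>?t k\<close> arrives one period later; nothing arrives at the first firing time
    \<open>?t 0\<close>.\<close>
  have spikes: "spikes_at Pre \<tau> (\<lambda>_. ?g) j t = (if \<exists>k. t = ?t (Suc k) then Pre j else {})" for j t
  proof -
    have "0 \<le> t - \<tau> \<and> ?g (t - \<tau>) = 1 \<longleftrightarrow> (\<exists>k. t = ?t (Suc k))"
    proof
      assume "0 \<le> t - \<tau> \<and> ?g (t - \<tau>) = 1"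
      then obtain k where "t - \<tau> = ?t k"
        using fires_iff by blast
      then have "t = ?t (Suc k)"
        by (simp add: algebra_simps)
      then show "\<exists>k. t = ?t (Suc k)" ..
    next
      assume "\<exists>k. t = ?t (Suc k)"
      then obtain k where "t - \<tau> = ?t k"
        by (auto simp: algebra_simps)
      then show "0 \<le> t - \<tau> \<and> ?g (t - \<tau>) = 1"
        using at_t[of k] t_nonneg[of k] \<open>c \<le> 1\<close> by simp
    qed
    then show ?thesis
      by (auto simp: spikes_at_iff)
  qed
  have "?g 0 = c"
    using \<open>0 < \<tau>\<close> \<open>c \<le> 1\<close> by (rule synchronous_phase_0)
  moreover have "?g t \<in> {0..1}" if "0 \<le> t" for t
    using cover[OF that] at_t by force
  \<comment> \<open>Spikes arrive only at firing times, so a phase other than 1 already places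
    \<open>t\<close> inside an interval from \<open>cover\<close>. Time 0 is included because that
    interval then reaches below 0.\<close>
  moreover have "(?g has_real_derivative 1) (at t within {0..})" if "0 \<le> t" "?g t \<noteq> 1" for t
  proof -
    have "\<nexists>k. t = ?t k"
      using fires_iff that by blast
    then obtain a b where "a < t" "t < b" "\<And>s. a < s \<Longrightarrow> s < b \<Longrightarrow> ?g s = 0 + (s - a)"
      using cover[OF \<open>0 \<le> t\<close>] by blast
    from affine_has_derivative[OF this] show ?thesis
      by (rule has_field_derivative_at_within)
  qed
  moreover have "(?g \<longlongrightarrow> (if ?g t = 1 then 0 else ?g t)) (at_right t)" if "0 \<le> t" for t
  proof (cases "\<exists>k. t = ?t k")
    case True
    then obtain k where k: "t = ?t k" ..
    have "(?g \<longlongrightarrow> 0) (at_right (?t k))"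
      using \<open>0 < \<tau>\<close> synchronous_phase_between[OF \<open>0 < \<tau>\<close>, of c k] Suc_t[of k]
      by (intro affine_at_right[where b = "?t (Suc k)"]) auto
    then show ?thesis
      using at_t[of k] by (simp add: k)
  next
    case False
    then obtain a b where ab: "a < t" "t < b" "\<And>s. a < s \<Longrightarrow> s < b \<Longrightarrow> ?g s = 0 + (s - a)"
      using cover[OF \<open>0 \<le> t\<close>] by blast
    have "(?g \<longlongrightarrow> t - a) (at_right t)"
      using ab by (intro affine_at_right[where b = b]) auto
    then show ?thesis
      using fires_iff[OF that] False ab by auto
  qed
  moreover have "\<exists>l. (?g \<longlongrightarrow> l) (at_left t) \<and>
        ?g t = (if spikes_at Pre \<tau> (\<lambda>_. ?g) j t = {} then l
           else inv_into {0..1} f (min 1 (f l + (\<Sum>i\<in>spikes_at Pre \<tau> (\<lambda>_. ?g) j t. w i j))))"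
    if "0 < t" for j t
  proof (cases "\<exists>k. t = ?t k")
    case True
    then obtain k where k: "t = ?t k" ..
    show ?thesis
    proof (cases k)
      \<comment> \<open>This firing is unforced: the phase drifts up to the left limit 1, which is
        the witness.\<close>
      case 0
      have "(?g \<longlongrightarrow> 0 + (1 - c - (- c))) (at_left (1 - c))"
        using \<open>0 < c\<close> synchronous_phase_before[OF \<open>0 < \<tau>\<close>] by (intro affine_at_left) auto
      moreover have "spikes_at Pre \<tau> (\<lambda>_. ?g) j t = {}"
        using 0 k \<open>0 < \<tau>\<close> by (auto simp: spikes add_nonneg_eq_0_iff)
      ultimately show ?thesis
        using at_t[of 0] 0 k by (intro exI[of _ 1]) simp
    next
      \<comment> \<open>Later firings are forced: the left limit is only \<tau>, and the full volley
        lifts the phase to 1.\<close>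
      case (Suc m)
      have "(?g \<longlongrightarrow> 0 + (?t (Suc m) - ?t m)) (at_left (?t (Suc m)))"
        using \<open>0 < \<tau>\<close> synchronous_phase_between[OF \<open>0 < \<tau>\<close>, of c m] Suc_t[of m]
        by (intro affine_at_left) auto
      moreover have "spikes_at Pre \<tau> (\<lambda>_. ?g) j t = Pre j"
        using Suc k by (auto simp: spikes)
      ultimately show ?thesis
        using at_t[of k] full_volley_jump[OF f net sup, of j] Suc_t[of m]
          coupling_network_Pre_nonempty[OF net \<open>0 < \<epsilon>\<close>, of j]
        by (intro exI[of _ \<tau>]) (simp add: k Suc)
    qed
  next
    case False
    have "0 \<le> t"
      using that by simp
    then obtain a b where ab: "a < t" "t < b" "\<And>s. a < s \<Longrightarrow> s < b \<Longrightarrow> ?g s = 0 + (s - a)"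
      using cover[of t] False by blast
    have "(?g \<longlongrightarrow> 0 + (t - a)) (at_left t)"
      using ab by (intro affine_at_left) auto
    moreover have "spikes_at Pre \<tau> (\<lambda>_. ?g) j t = {}"
      using False by (auto simp: spikes simp del: of_nat_Suc)
    ultimately show ?thesis
      using ab by (intro exI[of _ "t - a"]) simp
  qed
  ultimately show ?thesis
    using \<open>0 < c\<close> \<open>c \<le> 1\<close> unfolding solution_def by auto
qed

text \<open>Existence accompanies the universal claim for each \<open>c\<close>, so that the
  assertion of synchrony is never vacuous.\<close>

theorem mainTheorem2:
  fixes f :: "real \<Rightarrow> real"
    and Pre :: "'n::finite \<Rightarrow> 'n set"
    and w :: "'n \<Rightarrow> 'n \<Rightarrow> real"
    and \<tau> \<epsilon> :: real
  assumes "rise_function f"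
    and "coupling_network Pre w \<epsilon>"
    and "0 < \<tau>" "\<tau> < 1"
    and "0 < \<epsilon>" "\<epsilon> < 1"
    and "f \<tau> + \<epsilon> \<ge> 1"
  shows "(\<exists>\<phi>. solution f Pre w \<tau> \<phi> \<and>
            (\<exists>i s t. successive_firings \<phi> i s t \<and> t - s \<le> \<tau>)) \<and>
         (\<forall>c. 0 < c \<and> c \<le> 1 \<longrightarrow>
            (\<exists>\<phi>. solution f Pre w \<tau> \<phi> \<and> (\<forall>i. \<phi> i 0 = c)) \<and>
            (\<forall>\<phi>. solution f Pre w \<tau> \<phi> \<and> (\<forall>i. \<phi> i 0 = c) \<longrightarrow>
               synchronous_with_period \<phi> \<tau>))"
proof -
  have sol: "solution f Pre w \<tau> (\<lambda>_. synchronous_phase c \<tau>)" if "0 < c" "c \<le> 1" for c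
    using solution_synchronous_phase[OF assms(1-5,7) that] .
  have sync: "synchronous_with_period \<phi> \<tau>"
    if "solution f Pre w \<tau> \<phi>" "\<forall>i. \<phi> i 0 = c" for \<phi> c
    using solution_synchronous[OF assms(1-5,7) that(1)] that(2) by blast
  \<comment> \<open>Any admissible \<open>c\<close> yields a short interval; with
    \<open>c = 1\<close> the first firing is at time 0.\<close>
  let ?\<phi> = "\<lambda>_::'n. synchronous_phase 1 \<tau>"
  have "solution f Pre w \<tau> ?\<phi>" "synchronous_with_period ?\<phi> \<tau>"
    using sol[of 1] sync[of ?\<phi> 1] synchronous_phase_0[OF assms(3), of 1] by simp_all
  then obtain i s t where "successive_firings ?\<phi> i s t" "t - s \<le> \<tau>"
    unfolding synchronous_with_period_def by (metis ex_in_conv order_refl)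
  with \<open>solution f Pre w \<tau> ?\<phi>\<close> have
    "\<exists>\<phi>. solution f Pre w \<tau> \<phi> \<and> (\<exists>i s t. successive_firings \<phi> i s t \<and> t - s \<le> \<tau>)"
    by blast
  moreover have "\<exists>\<phi>. solution f Pre w \<tau> \<phi> \<and> (\<forall>i. \<phi> i 0 = c)" if "0 < c" "c \<le> 1" for c
    using sol[OF that] synchronous_phase_0[OF assms(3) that(2)] by auto
  ultimately show ?thesis
    using sync by blast
qed

end
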